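(* Let $a,h,d,b$ be positive integers with $b\ge4$ and $\gcd(a,d)=1$, and let $A(a)=(a,ha+d,ha+2d,ha+bd,ha+(b+1)d,ha+2bd)$. Write $Q=\left\lfloor\frac{a}{2b}\right\rfloor$. If $b$ is even, $h\ge\left\lceil\frac{2d}{b-2}\right\rceil$ and $a\ge b(b-2)$, then $$g(A(a))=\begin{cases}(Q+\tfrac b2-1)ha+2bdQ-a-d & \text{if } a\equiv 0,1,\dots,b-3\pmod{2b},\\ (Q+\tfrac b2-1)ha+2bdQ-a+bd-3d & \text{if } a\equiv b-2\pmod{2b},\\ (Q+\tfrac b2-1)ha+2bdQ-a+bd-2d & \text{if } a\equiv b-1\pmod{2b},\\ (Q+\tfrac b2)ha+2bdQ-a+bd-d & \text{if } a\equiv b,b+1,\dots,2b-2\pmod{2b},\\ (Q+\tfrac b2)ha+2bdQ-a+2bd-2d & \text{if } a\equiv 2b-1\pmod{2b}.\end{cases}$$ If $b$ is odd, $h\ge\left\lceil\frac{2d}{b-1}\right\rceil$ and $a\ge b(b-1)$, then $$g(A(a))=\begin{cases}(Q+\tfrac{b-1}2)ha+2bdQ-a-d & \text{if } a\equiv 0,1,\dots,b-2\pmod{2b},\\ (Q+\tfrac{b-1}2)ha+2bdQ-a+bd-2d & \text{if } a\equiv b-1\pmod{2b},\\ (Q+\tfrac{b-1}2)ha+2bdQ-a+bd-d & \text{if } a\equiv b,b+1,\dots,2b-3\pmod{2b},\\ (Q+\tfrac{b-1}2)ha+2bdQ-a+2bd-3d & \text{if } a\equiv 2b-2\pmod{2b},\\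 (Q+\tfrac{b-1}2)ha+2bdQ-a+2bd-2d & \text{if } a\equiv 2b-1\pmod{2b}.\end{cases}$$
   Context: For positive integers $a_1,\dots,a_n$ with $\gcd=1$, the Frobenius number $g(a_1,\dots,a_n)$ is the largest integer not representable as $\sum x_ia_i$ with nonnegative integers $x_i$. *)

theory Defs
  imports Complex_Main
begin

definition representable :: "nat list \<Rightarrow> int \<Rightarrow> bool" where
  "representable as n \<longleftrightarrow>
     (\<exists>x :: nat \<Rightarrow> nat. n = (\<Sum>i<length as. int (x i) * int (as ! i)))"

text \<open>
  The maximum is taken over all integers, negative ones included, so the value is \<open>-1\<close> when
  \<open>1\<close> is a generator. If the gcd of the generators is not \<open>1\<close>, there is no largest
  non-representable integer and the value is unspecified.
\<close>

definition frobenius_number :: "nat list \<Rightarrow> int" where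
  "frobenius_number as = (GREATEST n. \<not> representable as n)"

end

theory Submission
  imports Defs "HOL-Number_Theory.Cong"
begin

text \<open>
  Write \<open>w M = M div b + M mod b\<close>, the least number of summands \<open>1\<close> and \<open>b\<close> adding up to \<open>M\<close>.
  Each of \<open>1, 2, b, b + 1, 2 * b\<close> is a sum of at most two such summands, and pairing them up shows
  that \<open>\<lceil>w M / 2\<rceil>\<close> is the least number of summands from \<open>{1, 2, b, b + 1, 2 * b}\<close> adding up
  to \<open>M\<close>. As \<open>a \<ge> b * (b - 2)\<close>, we have \<open>w M \<le> w (M + a)\<close>, hence for \<open>r < a\<close> the least
  representable number congruent to \<open>r * d\<close> modulo \<open>a\<close> is \<open>\<lceil>w r / 2\<rceil> * h * a + r * d\<close>. The
  Frobenius number is the maximum of these values over \<open>r < a\<close>, minus \<open>a\<close>. The lower bound on \<open>h\<close>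
  makes one unit of \<open>\<lceil>w r / 2\<rceil>\<close> outweigh a difference of at most \<open>b\<close> in \<open>r\<close>, which
  determines the maximiser.
\<close>

section \<open>Minimal numbers of summands\<close>

definition digit_weight :: "nat \<Rightarrow> nat \<Rightarrow> nat" where
  "digit_weight b M = M div b + M mod b"

definition coin_count :: "nat \<Rightarrow> nat \<Rightarrow> nat" where
  "coin_count b M = (digit_weight b M + 1) div 2"

lemma digit_weight_mult_add: "v < b \<Longrightarrow> digit_weight b (b * u + v) = u + v"
  by (simp add: digit_weight_def)

lemma digit_weight_Suc: "digit_weight b (M + 1) \<le> digit_weight b M + 1"
  by (auto simp: digit_weight_def div_Suc mod_Suc)

text \<open>Passing from \<open>x\<close> to \<open>x + 1\<close> raises the weight by at most one,
  also at a carry, so \<open>x\<close> has weight at most \<open>x\<close>; adding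
  \<open>b * y\<close> only raises the quotient, by \<open>y\<close>.\<close>

lemma digit_weight_le:
  assumes "b > 0"
  shows "digit_weight b (b * y + x) \<le> x + y"
proof -
  have "digit_weight b x \<le> x" for x
  proof (induction x)
    case (Suc x)
    then show ?case using digit_weight_Suc[of b x] by simp
  qed (simp add: digit_weight_def)
  moreover have "digit_weight b (b * y + x) = digit_weight b x + y"
    using assms by (simp add: digit_weight_def)
  ultimately show ?thesis by (simp add: add.commute)
qed

text \<open>Splitting \<open>2\<close>, \<open>b + 1\<close> and \<open>2 * b\<close> into two units
  from \<open>{1, b}\<close> turns \<open>k\<close> coins into at most \<open>2 * k\<close> units,
  which bounds the weight of the total.\<close>

lemma coin_count_le:
  assumes "b > 0"
  shows "coin_count b (x1 + 2 * x2 + b * x3 + (b + 1) * x4 + 2 * b * x5) \<le> x1 + x2 + x3 + x4 + x5"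
proof -
  have "x1 + 2 * x2 + b * x3 + (b + 1) * x4 + 2 * b * x5
      = b * (x3 + x4 + 2 * x5) + (x1 + 2 * x2 + x4)"
    by (simp add: algebra_simps)
  then have "digit_weight b (x1 + 2 * x2 + b * x3 + (b + 1) * x4 + 2 * b * x5)
      \<le> (x1 + 2 * x2 + x4) + (x3 + x4 + 2 * x5)"
    using digit_weight_le[OF assms] by metis
  then show ?thesis by (simp add: coin_count_def)
qed

text \<open>Equal units pair into coins \<open>2 * b\<close> and \<open>2\<close>. When both digits
  are odd, the two leftovers merge into one coin \<open>b + 1\<close>, so at most one unit stays
  unpaired.\<close>

lemma coin_count_attained:
  "\<exists>x1 x2 x3 x4 x5. M = x1 + 2 * x2 + b * x3 + (b + 1) * x4 + 2 * b * x5 \<and>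
     x1 + x2 + x3 + x4 + x5 = coin_count b M"
proof -
  define u v where "u = M div b" and "v = M mod b"
  have M: "M = b * u + v" by (simp add: u_def v_def)
  have c: "coin_count b M = (u + v + 1) div 2"
    by (simp add: coin_count_def digit_weight_def u_def v_def)
  consider (ee) i j where "u = 2 * i" "v = 2 * j" | (eo) i j where "u = 2 * i" "v = 2 * j + 1"
    | (oe) i j where "u = 2 * i + 1" "v = 2 * j" | (oo) i j where "u = 2 * i + 1" "v = 2 * j + 1"
    by (metis oddE evenE)
  then show ?thesis
  proof cases
    case ee
    then show ?thesis unfolding c unfolding M
      by - (rule exI[of _ 0], rule exI[of _ j], rule exI[of _ 0], rule exI[of _ 0], rule exI[of _ i], simp)
  next
    case eo
    then show ?thesis unfolding c unfolding M
      by - (rule exI[of _ 1], rule exI[of _ j], rule exI[of _ 0], rule exI[of _ 0], rule exI[of _ i], simp)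
  next
    case oe
    then show ?thesis unfolding c unfolding M
      by - (rule exI[of _ 0], rule exI[of _ j], rule exI[of _ 1], rule exI[of _ 0], rule exI[of _ i], simp)
  next
    case oo
    then show ?thesis unfolding c unfolding M
      by - (rule exI[of _ 0], rule exI[of _ j], rule exI[of _ 0], rule exI[of _ 1], rule exI[of _ i], simp)
  qed
qed

section \<open>Monotonicity under adding \<open>a\<close>\<close>

text \<open>Without a carry the weight grows by \<open>U + t\<close>. A carry turns this into
  \<open>U + t + 1 - b\<close>; since it also forces \<open>t \<ge> 1\<close>, the bound
  \<open>U \<ge> b - 2\<close> from the size of \<open>a\<close> is just enough.\<close>

lemma digit_weight_mono_add:
  assumes "b > 0" and "a \<ge> b * (b - 2)"
  shows "digit_weight b M \<le> digit_weight b (M + a)"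
proof -
  define u v where "u = M div b" and "v = M mod b"
  define U t where "U = a div b" and "t = a mod b"
  have M: "M = b * u + v" and a: "a = b * U + t" by (simp_all add: u_def v_def U_def t_def)
  have v: "v < b" and t: "t < b" using assms by (simp_all add: v_def t_def)
  have U: "b - 2 \<le> U"
    using assms by (simp add: U_def less_eq_div_iff_mult_less_eq mult.commute)
  have "u + v \<le> digit_weight b (b * u + v + (b * U + t))"
  proof (cases "v + t < b")
    case True
    have "b * u + v + (b * U + t) = b * (u + U) + (v + t)" by (simp add: algebra_simps)
    then have "digit_weight b (b * u + v + (b * U + t)) = u + U + (v + t)"
      by (simp only: digit_weight_mult_add[OF True])
    then show ?thesis by simp
  next
    case False
    then have "b * u + v + (b * U + t) = b * (u + U + 1) + (v + t - b)"
      by (simp add: algebra_simps)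
    moreover have "v + t - b < b" using v t by simp
    ultimately have "digit_weight b (b * u + v + (b * U + t)) = u + U + 1 + (v + t - b)"
      using digit_weight_mult_add by metis
    then show ?thesis using False U v by simp
  qed
  then show ?thesis unfolding M a using digit_weight_mult_add[OF v] by simp
qed

lemma coin_count_mono_add_mult:
  assumes "b > 0" and "a \<ge> b * (b - 2)"
  shows "coin_count b r \<le> coin_count b (r + m * a)"
proof -
  have "digit_weight b r \<le> digit_weight b (r + m * a)"
  proof (induction m)
    case (Suc m)
    then show ?case
      using digit_weight_mono_add[OF assms, of "r + m * a"] by (simp add: algebra_simps)
  qed simp
  then show ?thesis by (simp add: coin_count_def div_le_mono)
qed

section \<open>Reduction of representability to minimal counts\<close>

lemma representable_iff:
  "representable [a, h*a + d, h*a + 2*d, h*a + b*d, h*a + (b+1)*d, h*a + 2*b*d] n \<longleftrightarrow>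
   (\<exists>x0 x1 x2 x3 x4 x5. n = int (x0 * a + (x1 + x2 + x3 + x4 + x5) * h * a
      + (x1 + 2 * x2 + b * x3 + (b + 1) * x4 + 2 * b * x5) * d))"
  (is "representable ?A n \<longleftrightarrow> ?R")
proof
  assume "representable ?A n"
  then obtain x :: "nat \<Rightarrow> nat" where
    x: "n = (\<Sum>i<length ?A. int (x i) * int (?A ! i))"
    unfolding representable_def by blast
  show ?R
    by (rule exI[of _ "x 0"], rule exI[of _ "x 1"], rule exI[of _ "x 2"],
        rule exI[of _ "x 3"], rule exI[of _ "x 4"], rule exI[of _ "x 5"])
      (simp add: x lessThan_Suc numeral_eq_Suc algebra_simps)
next
  assume ?R
  then obtain x0 x1 x2 x3 x4 x5 where
    n: "n = int (x0 * a + (x1 + x2 + x3 + x4 + x5) * h * a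
      + (x1 + 2 * x2 + b * x3 + (b + 1) * x4 + 2 * b * x5) * d)"
    by blast
  show "representable ?A n"
    unfolding representable_def
    by (rule exI[of _ "\<lambda>i. [x0, x1, x2, x3, x4, x5] ! i"])
      (simp add: n lessThan_Suc numeral_eq_Suc algebra_simps)
qed

text \<open>Every coin carries the same summand \<open>h * a\<close>, so \<open>j\<close> coins
  beyond the minimum amount to \<open>j * h\<close> further copies of the generator
  \<open>a\<close>.\<close>

lemma representable_iff_coin_count:
  assumes "b > 0"
  shows "representable [a, h*a + d, h*a + 2*d, h*a + b*d, h*a + (b+1)*d, h*a + 2*b*d] n \<longleftrightarrow>
    (\<exists>x M. n = int (x * a + coin_count b M * h * a + M * d))"
  unfolding representable_iff
proof
  assume "\<exists>x0 x1 x2 x3 x4 x5. n = int (x0 * a + (x1 + x2 + x3 + x4 + x5) * h * a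
      + (x1 + 2 * x2 + b * x3 + (b + 1) * x4 + 2 * b * x5) * d)"
  then obtain x0 x1 x2 x3 x4 x5 where
    n: "n = int (x0 * a + (x1 + x2 + x3 + x4 + x5) * h * a
      + (x1 + 2 * x2 + b * x3 + (b + 1) * x4 + 2 * b * x5) * d)" (is "_ = int (_ + ?k * h * a + ?M * d)")
    by blast
  obtain j where j: "?k = coin_count b ?M + j"
    using coin_count_le[OF assms] le_iff_add by blast
  have "n = int ((x0 + j * h) * a + coin_count b ?M * h * a + ?M * d)"
    unfolding n j by (simp only: algebra_simps)
  then show "\<exists>x M. n = int (x * a + coin_count b M * h * a + M * d)" by blast
next
  assume "\<exists>x M. n = int (x * a + coin_count b M * h * a + M * d)"
  then show "\<exists>x0 x1 x2 x3 x4 x5. n = int (x0 * a + (x1 + x2 + x3 + x4 + x5) * h * a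
      + (x1 + 2 * x2 + b * x3 + (b + 1) * x4 + 2 * b * x5) * d)"
    using coin_count_attained by metis
qed

section \<open>The Frobenius number as a maximum over residues\<close>

text \<open>Since \<open>d\<close> is invertible modulo \<open>a\<close>, the candidates for
  \<open>r < a\<close> meet every residue class once, each being the least representable number of
  its class. The greatest non-representable number of a class lies \<open>a\<close> below it, so the
  class of the maximiser \<open>rs\<close> decides.\<close>

lemma frobenius_number_eqI:
  fixes a h d b rs :: nat
  assumes "a > 0" and "b > 0" and "coprime a d" and "a \<ge> b * (b - 2)" and "rs < a"
    and max: "\<And>r. r < a \<Longrightarrow> coin_count b r * h * a + r * d \<le> coin_count b rs * h * a + rs * d"
  shows "frobenius_number [a, h*a + d, h*a + 2*d, h*a + b*d, h*a + (b+1)*d, h*a + 2*b*d]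
    = int (coin_count b rs * h * a + rs * d) - int a"
  unfolding frobenius_number_def representable_iff_coin_count[OF \<open>b > 0\<close>]
proof (rule Greatest_equality)
  let ?N = "coin_count b rs * h * a + rs * d"
  show "\<nexists>x M. int ?N - int a = int (x * a + coin_count b M * h * a + M * d)"
  proof
    assume "\<exists>x M. int ?N - int a = int (x * a + coin_count b M * h * a + M * d)"
    then obtain x M where "int ?N - int a = int (x * a + coin_count b M * h * a + M * d)"
      by blast
    then have eq: "?N = a + x * a + coin_count b M * h * a + M * d" by linarith
    \<comment> \<open>Modulo \<open>a\<close> only the multiples of \<open>d\<close> survive;
      cancelling \<open>d\<close> makes \<open>M\<close> equal to \<open>rs\<close> plus a
      nonnegative multiple of \<open>a\<close>, as \<open>rs < a\<close>.\<close>
    have "(rs * d) mod a = ?N mod a" by simp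
    also have "\<dots> = (M * d + (1 + x + coin_count b M * h) * a) mod a"
      unfolding eq by (simp add: algebra_simps)
    also have "\<dots> = (M * d) mod a" by (rule mod_mult_self1)
    finally have "[rs * d = M * d] (mod a)" by (simp add: cong_def)
    then have "[rs = M] (mod a)"
      using \<open>coprime a d\<close> by (simp add: cong_mult_rcancel_nat coprime_commute)
    then have "M = rs + (M div a) * a"
      using \<open>rs < a\<close> by (metis cong_def mod_less mod_div_mult_eq)
    then obtain m where M: "M = rs + m * a" by blast
    have "coin_count b rs * (h * a) \<le> coin_count b M * (h * a)"
      unfolding M using coin_count_mono_add_mult assms by (intro mult_right_mono) auto
    moreover have "rs * d \<le> M * d" by (simp add: M)
    ultimately show False using eq \<open>a > 0\<close> unfolding mult.assoc by linarith
  qed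
next
  let ?N = "coin_count b rs * h * a + rs * d"
  fix n :: int
  assume n: "\<nexists>x M. n = int (x * a + coin_count b M * h * a + M * d)"
  show "n \<le> int ?N - int a"
  proof (rule ccontr)
    assume "\<not> n \<le> int ?N - int a"
    then have gt: "n > int ?N - int a" by simp
    obtain y where y: "[int d * y = n] (mod int a)"
      using cong_solve_coprime_int[of "int d" "int a"] \<open>coprime a d\<close>
      by (metis cong_scalar_right coprime_commute coprime_int_iff mult.assoc mult_1)
    define r where "r = nat (y mod int a)"
    have r: "int r = y mod int a" "r < a" using \<open>a > 0\<close> by (simp_all add: r_def nat_less_iff)
    let ?K = "coin_count b r * h * a + r * d"
    have "[int r = y] (mod int a)" using r by (simp add: cong_def)
    then have "[int d * int r = n] (mod int a)"
      using y cong_scalar_left cong_trans by blast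
    then have "[int ?K = n] (mod int a)"
      by (simp add: cong_def mult.commute)
    then have "[n = int ?K] (mod int a)" by (rule cong_sym)
    then obtain k where k: "n = int ?K + int a * k"
      by (metis cong_iff_lin cong_sym)
    have "int ?K \<le> int ?N" using max[OF r(2)] by (simp only: of_nat_le_iff)
    \<comment> \<open>\<open>n\<close> is congruent to \<open>?K\<close> and exceeds
      \<open>?K - a\<close>, so \<open>k\<close> is an integer above \<open>-1\<close> and counts
      the copies of \<open>a\<close>.\<close>
    then have "int a * k > int a * (-1)" using gt k by simp
    then have "k \<ge> 0" using \<open>a > 0\<close> by (simp only: mult_less_cancel_left_pos of_nat_0_less_iff)
    then have "n = int (nat k * a + coin_count b r * h * a + r * d)"
      using k by (simp add: algebra_simps)
    then show False using n by blast
  qed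
qed

section \<open>The maximiser in base \<open>b\<close>\<close>

text \<open>Writing \<open>r = b * u + v\<close> turns \<open>r < a\<close> into a lexicographic
  condition and the maximality test into linear arithmetic. \<open>u + v \<le> 2 * N\<close> means a
  count of at most \<open>N\<close>. \<open>u + v + 2 \<le> 2 * N\<close> means at most
  \<open>N - 1\<close>, and the saved \<open>h * a\<close> pays for exceeding the maximiser by at
  most \<open>b\<close>, because \<open>b * d \<le> h * a\<close>.\<close>

lemma frobenius_number_digits:
  fixes a h d b U t us vs N :: nat
  assumes "a > 0" and "coprime a d" and "a \<ge> b * (b - 2)" and "b * d \<le> h * a"
    and a: "a = b * U + t" and "t < b" and "vs < b"
    and N: "N = (us + vs + 1) div 2"
    and rs: "us < U \<or> us = U \<and> vs < t"
    and max: "\<And>u v. v < b \<Longrightarrow> u < U \<or> u = U \<and> v < t \<Longrightarrow>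
      (u < us \<or> u = us \<and> v \<le> vs) \<and> u + v \<le> 2 * N \<or>
      (u = us + 1 \<and> v \<le> vs) \<and> u + v + 2 \<le> 2 * N"
  shows "frobenius_number [a, h*a + d, h*a + 2*d, h*a + b*d, h*a + (b+1)*d, h*a + 2*b*d]
    = int (N * h * a + (b * us + vs) * d) - int a"
proof -
  have lex: "b * u + v < b * u' + v'" if "v < b" "u < u' \<or> u = u' \<and> v < v'" for u v u' v'
  proof (cases "u < u'")
    case True
    then have "b * (u + 1) \<le> b * u'" by (intro mult_le_mono2) simp
    then show ?thesis using that by (simp add: algebra_simps)
  next
    case False
    then show ?thesis using that by simp
  qed
  have cc: "coin_count b (b * u + v) = (u + v + 1) div 2" if "v < b" for u v
    using that by (simp add: coin_count_def digit_weight_mult_add)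
  have b: "b > 0" using \<open>t < b\<close> by simp
  have "frobenius_number [a, h*a + d, h*a + 2*d, h*a + b*d, h*a + (b+1)*d, h*a + 2*b*d]
    = int (coin_count b (b * us + vs) * h * a + (b * us + vs) * d) - int a"
  proof (rule frobenius_number_eqI)
    show "b * us + vs < a" unfolding a using lex rs \<open>vs < b\<close> by blast
    fix r assume "r < a"
    define u v where "u = r div b" and "v = r mod b"
    have r: "r = b * u + v" and v: "v < b" using b by (simp_all add: u_def v_def)
    have "u < U \<or> u = U \<and> v < t"
    proof (rule ccontr)
      assume "\<not> ?thesis"
      then have "U < u \<or> U = u \<and> t < v \<or> U = u \<and> t = v" by linarith
      then have "a \<le> r" unfolding a r using lex[OF \<open>t < b\<close>, of U u v] by auto
      then show False using \<open>r < a\<close> by simp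
    qed
    from max[OF v this]
    have "(u + v + 1) div 2 * h * a + (b * u + v) * d \<le> N * h * a + (b * us + vs) * d"
    proof (elim disjE conjE)
      assume "u + v \<le> 2 * N"
      then have "(u + v + 1) div 2 \<le> N" by linarith
      moreover assume "u < us"
      then have "b * u + v \<le> b * us + vs" using lex[OF v] less_imp_le by blast
      ultimately show ?thesis by (meson add_mono mult_le_mono1)
    next
      assume le: "u + v \<le> 2 * N" and uv: "u = us" "v \<le> vs"
      from le have "(u + v + 1) div 2 \<le> N" by linarith
      then show ?thesis using uv by (intro add_mono mult_right_mono) auto
    next
      assume le: "u + v + 2 \<le> 2 * N" and uv: "u = us + 1" "v \<le> vs"
      from le have "(u + v + 1) div 2 + 1 \<le> N" by linarith
      then have "((u + v + 1) div 2 + 1) * (h * a) \<le> N * (h * a)"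
        by (intro mult_right_mono) auto
      moreover have "(b * u + v) * d \<le> (b * us + vs + b) * d"
        using uv by (intro mult_right_mono) auto
      then have "(b * u + v) * d \<le> (b * us + vs) * d + b * d" by (simp only: distrib_right)
      ultimately show ?thesis using \<open>b * d \<le> h * a\<close>
        by (simp only: distrib_right mult.assoc)
    qed
    then show "coin_count b r * h * a + r * d \<le> coin_count b (b * us + vs) * h * a + (b * us + vs) * d"
      by (simp only: r cc[OF v] cc[OF \<open>vs < b\<close>] N)
  qed (use assms b in auto)
  then show ?thesis by (simp only: cc[OF \<open>vs < b\<close>] N[symmetric])
qed

section \<open>Case analysis modulo \<open>2 * b\<close>\<close>

theorem theorem4p6:
  fixes a h d b :: nat and A :: "nat list" and Q :: int
  assumes "a > 0" and "h > 0" and "d > 0" and "b \<ge> 4"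
    and "gcd a d = 1"
  defines "A \<equiv> [a, h*a + d, h*a + 2*d, h*a + b*d, h*a + (b+1)*d, h*a + 2*b*d]"
    and "Q \<equiv> \<lfloor>real a / (2 * real b)\<rfloor>"
  shows
    "(even b \<and> int h \<ge> \<lceil>2 * real d / (real b - 2)\<rceil> \<and> a \<ge> b * (b - 2) \<longrightarrow>
       (a mod (2*b) \<in> {0..b-3} \<longrightarrow>
          frobenius_number A = (Q + int b div 2 - 1) * int h * int a + 2 * int b * int d * Q - int a - int d) \<and>
       (a mod (2*b) = b - 2 \<longrightarrow>
          frobenius_number A = (Q + int b div 2 - 1) * int h * int a + 2 * int b * int d * Q - int a + int b * int d - 3 * int d) \<and>
       (a mod (2*b) = b - 1 \<longrightarrow>
          frobenius_number A = (Q + int b div 2 - 1) * int h * int a + 2 * int b * int d * Q - int a + int b * int d - 2 * int d) \<and>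
       (a mod (2*b) \<in> {b..2*b-2} \<longrightarrow>
          frobenius_number A = (Q + int b div 2) * int h * int a + 2 * int b * int d * Q - int a + int b * int d - int d) \<and>
       (a mod (2*b) = 2*b - 1 \<longrightarrow>
          frobenius_number A = (Q + int b div 2) * int h * int a + 2 * int b * int d * Q - int a + 2 * int b * int d - 2 * int d))
     \<and>
     (odd b \<and> int h \<ge> \<lceil>2 * real d / (real b - 1)\<rceil> \<and> a \<ge> b * (b - 1) \<longrightarrow>
       (a mod (2*b) \<in> {0..b-2} \<longrightarrow>
          frobenius_number A = (Q + (int b - 1) div 2) * int h * int a + 2 * int b * int d * Q - int a - int d) \<and>
       (a mod (2*b) = b - 1 \<longrightarrow>
          frobenius_number A = (Q + (int b - 1) div 2) * int h * int a + 2 * int b * int d * Q - int a + int b * int d - 2 * int d) \<and>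
       (a mod (2*b) \<in> {b..2*b-3} \<longrightarrow>
          frobenius_number A = (Q + (int b - 1) div 2) * int h * int a + 2 * int b * int d * Q - int a + int b * int d - int d) \<and>
       (a mod (2*b) = 2*b - 2 \<longrightarrow>
          frobenius_number A = (Q + (int b - 1) div 2) * int h * int a + 2 * int b * int d * Q - int a + 2 * int b * int d - 3 * int d) \<and>
       (a mod (2*b) = 2*b - 1 \<longrightarrow>
          frobenius_number A = (Q + (int b - 1) div 2) * int h * int a + 2 * int b * int d * Q - int a + 2 * int b * int d - 2 * int d))"
proof -
  define q where "q = a div (2*b)"
  define s where "s = a mod (2*b)"
  have Q: "Q = int q"
    unfolding Q_def q_def using floor_divide_of_nat_eq[of a "2*b", where ?'a = real] by simp
  have a1: "a = b * (2*q) + s"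
    using mult_div_mod_eq[of "2*b" a] by (simp only: q_def s_def ac_simps)
  \<comment> \<open>\<open>a1\<close> gives the base \<open>b\<close> digits of \<open>a\<close>
    when \<open>s < b\<close>; otherwise the quotient is \<open>2 * q + 1\<close> and
    \<open>a2\<close> gives them.\<close>
  then have a2: "a = b * (2*q + 1) + (s - b)" if "b \<le> s"
    using that by (simp add: algebra_simps)
  have "coprime a d" using \<open>gcd a d = 1\<close> by (simp add: coprime_iff_gcd_eq_1)
  \<comment> \<open>\<open>c\<close> is \<open>2\<close> for even and \<open>1\<close> for odd
    \<open>b\<close>.\<close>
  have common: "q > 0" "a \<ge> b * (b - 2)" "b * d \<le> h * a"
    if "a \<ge> b * (b - c)" "2 * d \<le> h * (b - c)" "c \<le> 2" for c
  proof -
    have "b * 2 \<le> b * (b - c)" using that \<open>b \<ge> 4\<close> by (intro mult_le_mono2) simp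
    then have "2*b \<le> a" using that(1) by linarith
    then show "q > 0" using \<open>b \<ge> 4\<close> by (simp add: q_def div_greater_zero_iff)
    have "b * (b - 2) \<le> b * (b - c)" using that by (intro mult_le_mono2) simp
    then show "a \<ge> b * (b - 2)" using that(1) by linarith
    have "b * (2 * d) \<le> b * (h * (b - c))" using that(2) by (rule mult_le_mono2)
    also have "\<dots> = h * (b * (b - c))" by simp
    also have "\<dots> \<le> h * a" using that(1) by (rule mult_le_mono2)
    finally show "b * d \<le> h * a" by simp
  qed
  show ?thesis (is "(?EH \<longrightarrow> ?E) \<and> (?OH \<longrightarrow> ?O)")
  proof (rule conjI; rule impI)
    assume ?EH
    then have "even b" and h: "2 * real d / (real b - 2) \<le> real h"
      and large: "a \<ge> b * (b - 2)"
      by (auto simp: ceiling_le_iff)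
    have "\<exists>j. b = 2*j + 4" using \<open>even b\<close> \<open>b \<ge> 4\<close> by presburger
    then obtain j where j: "b = 2*j + 4" by blast
    have "2 * real d \<le> real h * (real b - 2)"
      using h \<open>b \<ge> 4\<close> by (simp add: divide_le_eq)
    then have "real (2 * d) \<le> real (h * (b - 2))"
      using \<open>b \<ge> 4\<close> by (simp add: of_nat_diff)
    then have hd: "2 * d \<le> h * (b - 2)" by (simp only: of_nat_le_iff)
    note facts = common[OF large hd, simplified]
    \<comment> \<open>Call the numbers with a common quotient by \<open>b\<close> a block. The block
      before quotient \<open>2 * q\<close> has quotient \<open>2 * p + 1\<close>, which avoids
      truncated subtraction.\<close>
    obtain p where p: "q = p + 1" using facts(1) by (metis Suc_eq_plus1 gr0_conv_Suc)
    have c1: "frobenius_number A = (Q + int b div 2 - 1) * int h * int a + 2 * int b * int d * Q - int a - int d"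
      if s: "s \<in> {0..b-3}"
    proof -
      \<comment> \<open>The maximiser is \<open>2 * b * q - 1\<close>, the end of a block: in the
        top block, of quotient \<open>2 * q\<close>, remainders are at most \<open>b - 4\<close> and
        counts at least one smaller.\<close>
      have "frobenius_number A = int ((p+j+2) * h * a + (b * (2*p+1) + (2*j+3)) * d) - int a"
        unfolding A_def
        by (rule frobenius_number_digits[OF \<open>a > 0\<close> \<open>coprime a d\<close> facts(2,3)
          a1])
          (use s p j in auto)
      then show ?thesis by (simp add: Q p j algebra_simps)
    qed
    have c2: "frobenius_number A = (Q + int b div 2 - 1) * int h * int a + 2 * int b * int d * Q - int a + int b * int d - 3 * int d"
      if s: "s = b - 2"
    proof -
      \<comment> \<open>Remainder \<open>b - 3\<close> now occurs and attains the maximal count, so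
        the last candidate \<open>a - 1\<close> wins, as it does for
        \<open>s = b - 1\<close>.\<close>
      have "frobenius_number A = int ((q+j+1) * h * a + (b * (2*q) + (2*j+1)) * d) - int a"
        unfolding A_def
        by (rule frobenius_number_digits[OF \<open>a > 0\<close> \<open>coprime a d\<close> facts(2,3)
          a1])
          (use s j in auto)
      then show ?thesis by (simp add: Q j algebra_simps)
    qed
    have c3: "frobenius_number A = (Q + int b div 2 - 1) * int h * int a + 2 * int b * int d * Q - int a + int b * int d - 2 * int d"
      if s: "s = b - 1"
    proof -
      have "frobenius_number A = int ((q+j+1) * h * a + (b * (2*q) + (2*j+2)) * d) - int a"
        unfolding A_def
        by (rule frobenius_number_digits[OF \<open>a > 0\<close> \<open>coprime a d\<close> facts(2,3)
          a1])
          (use s j in auto)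
      then show ?thesis by (simp add: Q j algebra_simps)
    qed
    have c4: "frobenius_number A = (Q + int b div 2) * int h * int a + 2 * int b * int d * Q - int a + int b * int d - int d"
      if s: "s \<in> {b..2*b-2}"
    proof -
      \<comment> \<open>The top block now has quotient \<open>2 * q + 1\<close> and remainders at
        most \<open>b - 3\<close>, which leaves its counts below that of
        \<open>2 * b * q + b - 1\<close>, the end of the block before.\<close>
      have "frobenius_number A = int ((q+j+2) * h * a + (b * (2*q) + (2*j+3)) * d) - int a"
        unfolding A_def
        by (rule frobenius_number_digits[OF \<open>a > 0\<close> \<open>coprime a d\<close> facts(2,3)
          a2])
          (use s j in auto)
      then show ?thesis by (simp add: Q j algebra_simps)
    qed
    have c5: "frobenius_number A = (Q + int b div 2) * int h * int a + 2 * int b * int d * Q - int a + 2 * int b * int d - 2 * int d"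
      if s: "s = 2*b - 1"
    proof -
      \<comment> \<open>Remainder \<open>b - 2\<close> lifts the top block to the maximal count, so
        the maximiser is \<open>a - 1\<close>.\<close>
      have "frobenius_number A = int ((q+j+2) * h * a + (b * (2*q+1) + (2*j+2)) * d) - int a"
        unfolding A_def
        by (rule frobenius_number_digits[OF \<open>a > 0\<close> \<open>coprime a d\<close> facts(2,3)
          a2])
          (use s j in auto)
      then show ?thesis by (simp add: Q j algebra_simps)
    qed
    show ?E unfolding s_def[symmetric] by (intro conjI impI c1 c2 c3 c4 c5)
  next
    assume ?OH
    then have "odd b" and h: "2 * real d / (real b - 1) \<le> real h"
      and large: "a \<ge> b * (b - 1)"
      by (auto simp: ceiling_le_iff)
    have "\<exists>j. b = 2*j + 5" using \<open>odd b\<close> \<open>b \<ge> 4\<close> by presburger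
    then obtain j where j: "b = 2*j + 5" by blast
    have "2 * real d \<le> real h * (real b - 1)"
      using h \<open>b \<ge> 4\<close> by (simp add: divide_le_eq)
    then have "real (2 * d) \<le> real (h * (b - 1))"
      using \<open>b \<ge> 4\<close> by (simp add: of_nat_diff)
    then have hd: "2 * d \<le> h * (b - 1)" by (simp only: of_nat_le_iff)
    note facts = common[OF large hd, simplified]
    obtain p where p: "q = p + 1" using facts(1) by (metis Suc_eq_plus1 gr0_conv_Suc)
    have c1: "frobenius_number A = (Q + (int b - 1) div 2) * int h * int a + 2 * int b * int d * Q - int a - int d"
      if s: "s \<in> {0..b-2}"
    proof -
      \<comment> \<open>For odd \<open>b\<close> the weight of \<open>2 * b * q - 1\<close> is odd
        and its count is rounded up, so in the top block even remainder \<open>b - 3\<close> falls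
        one short. The range is one longer than for even \<open>b\<close>.\<close>
      have "frobenius_number A = int ((p+j+3) * h * a + (b * (2*p+1) + (2*j+4)) * d) - int a"
        unfolding A_def
        by (rule frobenius_number_digits[OF \<open>a > 0\<close> \<open>coprime a d\<close> facts(2,3)
          a1])
          (use s p j in auto)
      then show ?thesis by (simp add: Q p j algebra_simps)
    qed
    have c2: "frobenius_number A = (Q + (int b - 1) div 2) * int h * int a + 2 * int b * int d * Q - int a + int b * int d - 2 * int d"
      if s: "s = b - 1"
    proof -
      have "frobenius_number A = int ((q+j+2) * h * a + (b * (2*q) + (2*j+3)) * d) - int a"
        unfolding A_def
        by (rule frobenius_number_digits[OF \<open>a > 0\<close> \<open>coprime a d\<close> facts(2,3)
          a1])
          (use s j in auto)
      then show ?thesis by (simp add: Q j algebra_simps)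
    qed
    have c3: "frobenius_number A = (Q + (int b - 1) div 2) * int h * int a + 2 * int b * int d * Q - int a + int b * int d - int d"
      if s: "s \<in> {b..2*b-3}"
    proof -
      \<comment> \<open>The weight of \<open>2 * b * q + b - 1\<close> is even here, so remainder
        \<open>b - 3\<close> in the top block would already tie. This ends the range one earlier
        than for even \<open>b\<close> and makes \<open>a - 1\<close> the maximiser in the two
        remaining cases.\<close>
      have "frobenius_number A = int ((q+j+2) * h * a + (b * (2*q) + (2*j+4)) * d) - int a"
        unfolding A_def
        by (rule frobenius_number_digits[OF \<open>a > 0\<close> \<open>coprime a d\<close> facts(2,3)
          a2])
          (use s j in auto)
      then show ?thesis by (simp add: Q j algebra_simps)
    qed
    have c4: "frobenius_number A = (Q + (int b - 1) div 2) * int h * int a + 2 * int b * int d * Q - int a + 2 * int b * int d - 3 * int d"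
      if s: "s = 2*b - 2"
    proof -
      have "frobenius_number A = int ((q+j+2) * h * a + (b * (2*q+1) + (2*j+2)) * d) - int a"
        unfolding A_def
        by (rule frobenius_number_digits[OF \<open>a > 0\<close> \<open>coprime a d\<close> facts(2,3)
          a2])
          (use s j in auto)
      then show ?thesis by (simp add: Q j algebra_simps)
    qed
    have c5: "frobenius_number A = (Q + (int b - 1) div 2) * int h * int a + 2 * int b * int d * Q - int a + 2 * int b * int d - 2 * int d"
      if s: "s = 2*b - 1"
    proof -
      have "frobenius_number A = int ((q+j+2) * h * a + (b * (2*q+1) + (2*j+3)) * d) - int a"
        unfolding A_def
        by (rule frobenius_number_digits[OF \<open>a > 0\<close> \<open>coprime a d\<close> facts(2,3)
          a2])
          (use s j in auto)
      then show ?thesis by (simp add: Q j algebra_simps)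
    qed
    show ?O unfolding s_def[symmetric] by (intro conjI impI c1 c2 c3 c4 c5)
  qed
qed

end
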